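(* Let $N \ge 2$ and $T > 4$, let $\alpha = \frac{1}{\log T}$ and $$\eta = \left(\frac{4NT}{\alpha(1-\alpha)\sqrt{2\log N}}\right)^{1/(2-\alpha)}.$$ Run GBPA with the stochastically smoothed potential whose perturbation is $\eta Z$ with $Z$ a standard Gaussian random variable. Then for every sequence of gain vectors $g_1,\dots,g_T \in [-1,0]^N$ the expected regret is at most $$96\sqrt{NT}\, N^{1/\log T}\sqrt{\log N}\,\log T .$$ If moreover $T > N$, the expected regret is at most $278\sqrt{NT}\sqrt{\log N}\,\log T$.
   Context: Adversarial multi-armed bandit: there are $N$ arms and $T$ rounds; an oblivious adversary fixes gain vectors $g_1,\dots,g_T \in [-1,0]^N$ in advance. For a random variable $W$ with a continuous distribution on $\mathbb{R}$ and finite expectation, the stochastically smoothed potential is $\tilde\Phi(G) = \mathbb{E}[\max_{i}(G_i + W_i)]$ for $G\in\mathbb{R}^N$, where $W_1,\dots,W_N$ are i.i.d. copies of $W$; it is convex and differentiable with $\nabla_i\tilde\Phi(G) = \mathbb{P}(i = \arg\max_j (G_j+W_j))$, so $\nabla\tilde\Phi(G)$ lies in the probability simplex. "Perturbation $\eta Z$" means $W = \eta Z$. The algorithm GBPA$(\tilde\Phi)$: set $\hat G_0 = 0$; for $t=1,\dots,T$: let $p_t = \nabla\tilde\Phi(\hat G_{t-1})$, draw arm $i_t \sim p_t$, observe only $g_{t,i_t}$, set $\hat g_t = \frac{g_{t,i_t}}{p_{t,i_t}} e_{i_t}$ ($e_i$ the $i$-th standard basis vector) and $\hat G_t = \hat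 G_{t-1} + \hat g_t$. The expected regret is $\mathbb{E}\big[\max_{i}\sum_{t=1}^T (g_{t,i} - g_{t,i_t})\big]$, the expectation being over the learner's random choices. $\log$ denotes the natural logarithm. *)

theory Defs
  imports "HOL-Probability.Probability"
begin

text \<open>Arms are indexed by a finite type 'n, so N = CARD('n). Gain vectors are real^'n.\<close>

definition std_gauss_vec :: "(real ^ 'n::finite) measure" where
  "std_gauss_vec = density lborel (\<lambda>w. ennreal (\<Prod>i\<in>UNIV. std_normal_density (w $ i)))"

definition gauss_smoothed_potential :: "real \<Rightarrow> real ^ 'n::finite \<Rightarrow> real" where
  "gauss_smoothed_potential eta G =
     (\<integral>w. Max (range (\<lambda>i. G $ i + eta * w $ i)) \<partial>std_gauss_vec)"

definition grad :: "(real ^ 'n::finite \<Rightarrow> real) \<Rightarrow> real ^ 'n \<Rightarrow> real ^ 'n" where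
  "grad Phi G = (\<chi> i. frechet_derivative Phi (at G) (axis i 1))"

text \<open>GBPA with gradient map P: for a realisation h of the learner's choices (h t = i_t),
  the cumulative gain estimate hat G_k.\<close>
fun gbpa_Ghat :: "(real ^ 'n::finite \<Rightarrow> real ^ 'n) \<Rightarrow> (nat \<Rightarrow> real ^ 'n) \<Rightarrow> (nat \<Rightarrow> 'n)
                   \<Rightarrow> nat \<Rightarrow> real ^ 'n" where
  "gbpa_Ghat P g h 0 = 0"
| "gbpa_Ghat P g h (Suc k) =
     gbpa_Ghat P g h k
     + ((g (Suc k) $ h (Suc k)) / (P (gbpa_Ghat P g h k) $ h (Suc k))) *\<^sub>R axis (h (Suc k)) 1"

definition gbpa_path_prob :: "(real ^ 'n::finite \<Rightarrow> real ^ 'n) \<Rightarrow> (nat \<Rightarrow> real ^ 'n) \<Rightarrow> nat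
                               \<Rightarrow> (nat \<Rightarrow> 'n) \<Rightarrow> real" where
  "gbpa_path_prob P g T h = (\<Prod>t\<in>{1..T}. P (gbpa_Ghat P g h (t - 1)) $ h t)"

definition regret :: "(nat \<Rightarrow> real ^ 'n::finite) \<Rightarrow> nat \<Rightarrow> (nat \<Rightarrow> 'n) \<Rightarrow> real" where
  "regret g T h = Max (range (\<lambda>i. \<Sum>t\<in>{1..T}. g t $ i - g t $ h t))"

definition gbpa_expected_regret :: "(real ^ 'n::finite \<Rightarrow> real) \<Rightarrow> (nat \<Rightarrow> real ^ 'n) \<Rightarrow> nat \<Rightarrow> real" where
  "gbpa_expected_regret Phi g T =
     (\<Sum>h\<in>({1..T} \<rightarrow>\<^sub>E (UNIV :: 'n set)). gbpa_path_prob (grad Phi) g T h * regret g T h)"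

end

theory Submission
  imports Defs
begin

text \<open>
  The potential \<open>\<Phi>\<close> is differentiable because ties between perturbed arms have probability zero, and
  its gradient \<open>p\<close> is the vector of probabilities of being the leader. Since \<open>\<Phi> G\<close> dominates every
  coordinate of \<open>G\<close>, tracking \<open>\<Phi>(G') - G'\<^sub>i\<close> along the estimates \<open>G'\<close> for the best arm \<open>i\<close>
  bounds the regret by
  \<open>\<Phi> 0\<close> plus the accumulated Bregman divergences of \<open>\<Phi>\<close>.

  When arm \<open>i\<close> loses \<open>s \<le> 1/p\<^sub>i\<close>, the divergence is at most \<open>s\<close> times the probability that \<open>i\<close> leads by
  less than \<open>s\<close>. Conditionally on the other arms this is a Gaussian probability of a window
  \<open>(y, y + s/\<eta>)\<close>. It is bounded both by the tail \<open>F(y)\<close> and by \<open>(s/\<eta>) e (1 + y\<^sup>+) F(y)\<close> (hazard rate);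
  interpolating with exponents \<open>\<alpha>\<close> and \<open>1 - \<alpha>\<close>, and absorbing \<open>1 + y\<^sup>+\<close> into \<open>F(y)\<^sup>\<alpha> \<le> exp (-\<alpha> (y\<^sup>+)\<^sup>2/2)\<close>,
  gives \<open>(6/\<alpha>) (s/\<eta>)\<^bsup>1-\<alpha>\<^esup> F(y)\<^bsup>1-\<alpha>\<^esup>\<close>. Averaging over \<open>y\<close> turns \<open>F(y)\<close> into \<open>p\<^sub>i\<close>, so that the expected
  divergence per round is at most \<open>(6/\<alpha>) N \<eta>\<^bsup>\<alpha>-1\<^esup>\<close>. With \<open>\<Phi> 0 \<le> \<eta> sqrt (2 ln N)\<close> the chosen \<open>\<eta>\<close>
  balances both contributions.
\<close>

subsection \<open>Standard Gaussian vectors as a product measure\<close>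

abbreviation std_normal :: "real measure" where
  "std_normal \<equiv> density lborel (\<lambda>x. ennreal (std_normal_density x))"

lemma prob_space_std_normal: "prob_space std_normal"
  by (rule prob_space_normal_density) simp

abbreviation std_normal_prod :: "('n::finite \<Rightarrow> real) measure" where
  "std_normal_prod \<equiv> PiM UNIV (\<lambda>_. std_normal)"

interpretation std_normal: prob_space std_normal
  by (rule prob_space_std_normal)

interpretation std_normal_prod: product_prob_space "\<lambda>_::'n::finite. std_normal" UNIV
  by unfold_locales

interpretation lborel_prod: product_sigma_finite "\<lambda>_::'n::finite. lborel :: real measure"
  by unfold_locales

lemma measurable_vec_lambda_PiM:
  "(vec_lambda :: ('n::finite \<Rightarrow> real) \<Rightarrow> _) \<in> borel_measurable (PiM UNIV (\<lambda>_. lborel))"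
proof -
  have "(\<lambda>x. (\<chi> i. x i) :: real ^ 'n) = (\<lambda>x. \<Sum>i\<in>UNIV. x i *\<^sub>R axis i 1)"
    by (auto simp: fun_eq_iff vec_eq_iff axis_def if_distrib cong: if_cong)
  also have "\<dots> \<in> borel_measurable (PiM UNIV (\<lambda>_. lborel))"
    by measurable
  finally show ?thesis by simp
qed

text \<open>Lebesgue measure is determined by the volumes of boxes, and \<open>vec_lambda\<close>
  pulls a box back to a product of intervals.\<close>

lemma lborel_vec_eq_distr_PiM:
  "(lborel :: (real ^ 'n::finite) measure) = distr (PiM UNIV (\<lambda>_. lborel)) borel vec_lambda"
proof (rule lborel_eqI)
  fix l u :: "real ^ 'n"
  assume le: "\<And>b. b \<in> Basis \<Longrightarrow> l \<bullet> b \<le> u \<bullet> b"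
  have le': "l $ i \<le> u $ i" for i
    using le[of "axis i 1"] by (simp add: axis_in_Basis_iff cart_eq_inner_axis)
  have vim: "vec_lambda -` box l u \<inter> space (PiM UNIV (\<lambda>_. lborel))
      = Pi\<^sub>E UNIV (\<lambda>i. {l $ i <..< u $ i})"
    by (auto simp: mem_box_cart space_PiM PiE_def Pi_def)
  have "emeasure (distr (PiM UNIV (\<lambda>_. lborel)) borel vec_lambda) (box l u)
      = emeasure (PiM UNIV (\<lambda>_. lborel)) (Pi\<^sub>E UNIV (\<lambda>i. {l $ i <..< u $ i}))"
    by (subst emeasure_distr) (auto simp: measurable_vec_lambda_PiM vim)
  also have "\<dots> = (\<Prod>i\<in>UNIV. ennreal (u $ i - l $ i))"
    by (subst lborel_prod.emeasure_PiM) (auto simp: le')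
  also have "\<dots> = ennreal (\<Prod>i\<in>UNIV. u $ i - l $ i)"
    by (rule prod_ennreal) (simp add: le')
  also have "(\<Prod>i\<in>UNIV. u $ i - l $ i) = (\<Prod>b\<in>Basis. (u - l) \<bullet> b)"
  proof -
    have B: "(Basis :: (real ^ 'n) set) = (\<lambda>i. axis i 1) ` UNIV"
      by (auto simp: Basis_vec_def)
    have inj: "inj (\<lambda>i. axis i 1 :: real ^ 'n)"
      by (auto simp: inj_def axis_eq_axis)
    show ?thesis
      unfolding B prod.reindex[OF inj] by (simp add: cart_eq_inner_axis inner_diff_left)
  qed
  finally show "emeasure (distr (PiM UNIV (\<lambda>_. lborel)) borel vec_lambda) (box l u)
      = ennreal (\<Prod>b\<in>Basis. (u - l) \<bullet> b)" .
qed simp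

lemma std_normal_prod_eq_density:
  "(std_normal_prod :: ('n::finite \<Rightarrow> real) measure)
     = density (PiM UNIV (\<lambda>_. lborel)) (\<lambda>x. ennreal (\<Prod>i\<in>UNIV. std_normal_density (x i)))"
proof (rule std_normal_prod.PiM_eqI[symmetric])
  fix A :: "'n \<Rightarrow> real set"
  assume "\<And>i. i \<in> UNIV \<Longrightarrow> A i \<in> sets std_normal"
  then have A [measurable]: "A i \<in> sets borel" for i
    by simp
  have "Pi\<^sub>E UNIV A \<in> sets (PiM UNIV (\<lambda>_. lborel))"
    by (intro sets_PiM_I_finite) auto
  then have "emeasure (density (PiM UNIV (\<lambda>_. lborel))
      (\<lambda>x. ennreal (\<Prod>i\<in>UNIV. std_normal_density (x i)))) (Pi\<^sub>E UNIV A)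
    = (\<integral>\<^sup>+x. ennreal (\<Prod>i\<in>UNIV. std_normal_density (x i)) * indicator (Pi\<^sub>E UNIV A) x
        \<partial>PiM UNIV (\<lambda>_. lborel))"
    by (subst emeasure_density) auto
  also have "\<dots> = (\<integral>\<^sup>+x. (\<Prod>i\<in>UNIV. ennreal (std_normal_density (x i)) * indicator (A i) (x i))
        \<partial>PiM UNIV (\<lambda>_. lborel))"
    by (intro nn_integral_cong)
       (auto simp: prod.distrib prod_ennreal[symmetric] indicator_def PiE_def Pi_def)
  also have "\<dots> = (\<Prod>i\<in>UNIV. \<integral>\<^sup>+x. ennreal (std_normal_density x) * indicator (A i) x \<partial>lborel)"
    by (rule lborel_prod.product_nn_integral_prod) auto
  also have "\<dots> = (\<Prod>i\<in>UNIV. emeasure std_normal (A i))"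
    by (intro prod.cong refl) (simp add: emeasure_density)
  finally show "emeasure (density (PiM UNIV (\<lambda>_. lborel))
      (\<lambda>x. ennreal (\<Prod>i\<in>UNIV. std_normal_density (x i)))) (Pi\<^sub>E UNIV A)
      = (\<Prod>i\<in>UNIV. emeasure std_normal (A i))" .
next
  show "sets (density (PiM UNIV (\<lambda>_::'n. lborel)) (\<lambda>x. ennreal (\<Prod>i\<in>UNIV. std_normal_density (x i))))
    = sets (std_normal_prod)"
    by (simp cong: sets_PiM_cong)
qed auto

text \<open>Transfers Gaussian vectors to a product measure, where a single coordinate can be
  integrated out by Fubini; the later estimates live there.\<close>

lemma std_gauss_vec_eq_distr:
  "(std_gauss_vec :: (real ^ 'n::finite) measure) = distr std_normal_prod borel vec_lambda"
  unfolding std_gauss_vec_def std_normal_prod_eq_density lborel_vec_eq_distr_PiM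
  by (subst density_distr) (auto simp: measurable_vec_lambda_PiM intro!: distr_cong)

subsection \<open>Tails of the standard normal distribution\<close>

lemma nn_integral_std_normal:
  assumes [measurable]: "f \<in> borel_measurable borel"
  shows "(\<integral>\<^sup>+x. f x \<partial>std_normal) = (\<integral>\<^sup>+x. ennreal (std_normal_density x) * f x \<partial>lborel)"
  by (subst nn_integral_density) auto

text \<open>Completing the square turns the tilted density into a constant times the normal density
  with mean \<open>l\<close>, which has mass one.\<close>

lemma nn_integral_std_normal_exp:
  "(\<integral>\<^sup>+x. ennreal (exp (l * x)) \<partial>std_normal) = ennreal (exp (l\<^sup>2 / 2))"
proof -
  have "(\<integral>\<^sup>+x. ennreal (exp (l * x)) \<partial>std_normal)
      = (\<integral>\<^sup>+x. ennreal (exp (l\<^sup>2 / 2)) * ennreal (normal_density l 1 x) \<partial>lborel)"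
  proof (subst nn_integral_std_normal, simp, rule nn_integral_cong)
    fix x :: real
    have "- x\<^sup>2 / 2 + l * x = l\<^sup>2 / 2 + - (x - l)\<^sup>2 / 2"
      by (simp add: power2_eq_square field_simps)
    then have "exp (- x\<^sup>2 / 2) * exp (l * x) = exp (l\<^sup>2 / 2) * exp (- (x - l)\<^sup>2 / 2)"
      by (simp only: exp_add[symmetric])
    then have "std_normal_density x * exp (l * x) = exp (l\<^sup>2 / 2) * normal_density l 1 x"
      by (simp add: normal_density_def)
    then show "ennreal (std_normal_density x) * ennreal (exp (l * x))
        = ennreal (exp (l\<^sup>2 / 2)) * ennreal (normal_density l 1 x)"
      by (simp add: ennreal_mult'[symmetric])
  qed
  also have "\<dots> = ennreal (exp (l\<^sup>2 / 2)) * (\<integral>\<^sup>+x. ennreal (normal_density l 1 x) \<partial>lborel)"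
    by (rule nn_integral_cmult) simp
  also have "(\<integral>\<^sup>+x. ennreal (normal_density l 1 x) \<partial>lborel) = 1"
    by (subst nn_integral_eq_integral)
       (auto simp: integral_normal_density integrable_normal_density)
  finally show ?thesis by simp
qed

lemma integrable_std_normal_exp: "integrable std_normal (\<lambda>x. exp (l * x))"
  by (rule integrableI_nonneg) (auto simp: nn_integral_std_normal_exp)

lemma integral_std_normal_exp: "(\<integral>x. exp (l * x) \<partial>std_normal) = exp (l\<^sup>2 / 2)"
  by (subst integral_eq_nn_integral) (auto simp: nn_integral_std_normal_exp)

lemma integrable_std_normal_id: "integrable std_normal (\<lambda>x. x)"
  using integrable_std_normal_moment[of 1] by (subst integrable_density) auto

lemma integral_std_normal_id: "(\<integral>x. x \<partial>std_normal) = 0"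
  using integral_std_normal_moment_odd[of 0] by (subst integral_density) auto

lemma std_normal_density_antimono:
  assumes "0 \<le> x" "x \<le> z" shows "std_normal_density z \<le> std_normal_density x"
  using assms by (simp add: std_normal_density_def divide_right_mono)

lemma std_normal_density_le_max0:
  assumes "y \<le> z" shows "std_normal_density z \<le> std_normal_density (max y 0)"
proof (cases "0 \<le> y")
  case True
  then show ?thesis using std_normal_density_antimono[of y z] assms by simp
next
  case False
  then show ?thesis by (simp add: std_normal_density_def divide_right_mono)
qed

lemma std_normal_interval_le:
  assumes "\<And>z. z \<in> {a<..<b} \<Longrightarrow> std_normal_density z \<le> c" "a \<le> b" "0 \<le> c"
  shows "std_normal.prob {a<..<b} \<le> c * (b - a)"
proof -
  have "emeasure std_normal {a<..<b}
      = (\<integral>\<^sup>+x. ennreal (std_normal_density x) * indicator {a<..<b} x \<partial>lborel)"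
    by (rule emeasure_density) auto
  also have "\<dots> \<le> (\<integral>\<^sup>+x. ennreal c * indicator {a<..<b} x \<partial>lborel)"
    by (intro nn_integral_mono) (auto simp: assms(1) ennreal_leI split: split_indicator)
  also have "\<dots> = ennreal (c * (b - a))"
    using assms(2,3) by (simp add: nn_integral_cmult_indicator ennreal_mult')
  finally show ?thesis
    using assms(2,3) by (simp add: std_normal.emeasure_eq_measure)
qed

lemma std_normal_interval_ge:
  assumes "\<And>z. z \<in> {a<..<b} \<Longrightarrow> c \<le> std_normal_density z" "a \<le> b" "0 \<le> c"
  shows "c * (b - a) \<le> std_normal.prob {a<..<b}"
proof -
  have "ennreal (c * (b - a)) = (\<integral>\<^sup>+x. ennreal c * indicator {a<..<b} x \<partial>lborel)"
    using assms(2,3) by (simp add: nn_integral_cmult_indicator ennreal_mult')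
  also have "\<dots> \<le> (\<integral>\<^sup>+x. ennreal (std_normal_density x) * indicator {a<..<b} x \<partial>lborel)"
    by (intro nn_integral_mono) (auto simp: assms(1) ennreal_leI split: split_indicator)
  also have "\<dots> = emeasure std_normal {a<..<b}"
    by (rule emeasure_density[symmetric]) auto
  finally show ?thesis
    by (simp add: std_normal.emeasure_eq_measure)
qed

section \<open>Hazard rate and decay of the Gaussian tail\<close>

definition gauss_tail :: "real \<Rightarrow> real" where
  "gauss_tail y = std_normal.prob {y<..}"

lemma gauss_tail_antimono: "x \<le> y \<Longrightarrow> gauss_tail y \<le> gauss_tail x"
  unfolding gauss_tail_def by (intro std_normal.finite_measure_mono) auto

lemma gauss_tail_le_1: "gauss_tail y \<le> 1"
  unfolding gauss_tail_def by (rule std_normal.prob_le_1)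

text \<open>With \<open>u = max y 0\<close> and \<open>d = 1 / (1 + u)\<close>, moving from
  \<open>u\<close> to \<open>u + d\<close> raises the exponent \<open>u\<^sup>2 / 2\<close> by at
  most one. The density thus drops by at most a factor \<open>exp 1\<close> on a window of width
  \<open>d\<close>, all of which counts towards the tail.\<close>

lemma gauss_hazard_rate_le:
  "std_normal_density (max y 0) \<le> exp 1 * (1 + max y 0) * gauss_tail y"
proof -
  define u where "u = max y 0"
  define d where "d = 1 / (1 + u)"
  have u: "0 \<le> u" "y \<le> u" and d: "0 < d" "d \<le> 1" and du: "d * (1 + u) = 1"
    by (auto simp: u_def d_def add_pos_nonneg)
  have "(u + d)\<^sup>2 / 2 \<le> u\<^sup>2 / 2 + 1"
  proof -
    have "d * d \<le> d" using d by (simp add: mult_left_le)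
    moreover have "d * u = 1 - d" using du by (simp add: algebra_simps)
    moreover have "(u + d)\<^sup>2 / 2 = u\<^sup>2 / 2 + d * u + d * d / 2"
      by (simp add: power2_eq_square algebra_simps add_divide_distrib)
    ultimately show ?thesis using d by linarith
  qed
  then have "exp (- u\<^sup>2 / 2) \<le> exp (1 + - (u + d)\<^sup>2 / 2)"
    by (subst exp_le_cancel_iff) simp
  also have "\<dots> = exp 1 * exp (- (u + d)\<^sup>2 / 2)"
    by (rule exp_add)
  finally have "std_normal_density u \<le> exp 1 * std_normal_density (u + d)"
    by (simp add: std_normal_density_def divide_right_mono)
  moreover have "std_normal_density (u + d) * d \<le> gauss_tail y"
  proof -
    have "std_normal_density (u + d) * (u + d - u) \<le> std_normal.prob {u<..<u + d}"
      using u d by (intro std_normal_interval_ge std_normal_density_antimono) auto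
    also have "\<dots> \<le> gauss_tail y"
      unfolding gauss_tail_def using u by (intro std_normal.finite_measure_mono) auto
    finally show ?thesis by simp
  qed
  then have "std_normal_density (u + d) \<le> (1 + u) * gauss_tail y"
    using u by (simp add: d_def field_simps)
  ultimately show ?thesis
    unfolding u_def[symmetric]
    by (smt (verit) exp_gt_zero mult.assoc mult_left_mono)
qed

lemma gauss_tail_pos: "0 < gauss_tail y"
proof -
  have "0 < exp 1 * (1 + max y 0) * gauss_tail y"
    using gauss_hazard_rate_le[of y] normal_density_pos[of 1 0 "max y 0"] by simp
  then show ?thesis
    by (rule zero_less_mult_pos) (simp add: add_pos_nonneg)
qed

text \<open>Chernoff bound with tilt \<open>u = max y 0\<close>: the indicator of the tail lies
  below \<open>exp (u * (x - u))\<close>. For negative \<open>y\<close> the tilt is zero and the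
  bound is 1.\<close>

lemma gauss_tail_le_exp: "gauss_tail y \<le> exp (- (max y 0)\<^sup>2 / 2)"
proof -
  define u where "u = max y 0"
  have "gauss_tail y = (\<integral>x. indicator {y<..} x \<partial>std_normal)"
    by (simp add: gauss_tail_def)
  also have "\<dots> \<le> (\<integral>x. exp (- u * u) * exp (u * x) \<partial>std_normal)"
  proof (rule integral_mono)
    show "integrable std_normal (\<lambda>x. indicator {y<..} x :: real)"
      by (simp add: std_normal.emeasure_eq_measure)
    show "integrable std_normal (\<lambda>x. exp (- u * u) * exp (u * x))"
      by (intro integrable_mult_right integrable_std_normal_exp)
    fix x :: real
    have "0 \<le> u * (x - u)" if "y < x"
      using that by (auto simp: u_def max_def mult_nonneg_nonneg)
    then show "indicator {y<..} x \<le> exp (- u * u) * exp (u * x)"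
      by (auto simp: indicator_def exp_add[symmetric] algebra_simps)
  qed
  also have "\<dots> = exp (- u * u) * exp (u\<^sup>2 / 2)"
    by (simp add: integral_std_normal_exp)
  also have "\<dots> = exp (- u\<^sup>2 / 2)"
    by (simp add: exp_add[symmetric] power2_eq_square)
  finally show ?thesis by (simp add: u_def)
qed

text \<open>Serves to absorb the linear growth of the hazard rate into Gaussian decay. The core is
  \<open>a * u \<le> 1 + a * u\<^sup>2 / 2\<close>, which follows from
  \<open>0 \<le> a * (u - 1)\<^sup>2\<close> and \<open>a \<le> 1\<close>.\<close>

lemma one_plus_mult_exp_le:
  fixes a u :: real
  assumes "0 < a" "a \<le> 1" "0 \<le> u"
  shows "(1 + u) * exp (- a * u\<^sup>2 / 2) \<le> 2 / a"
proof -
  define E where "E = exp (- a * u\<^sup>2 / 2)"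
  have E: "0 \<le> E" "E \<le> 1" using assms by (auto simp: E_def)
  have "1 + a * u\<^sup>2 / 2 \<le> exp (a * u\<^sup>2 / 2)" by (rule exp_ge_add_one_self)
  moreover have "a * u \<le> 1 + a * u\<^sup>2 / 2"
  proof -
    have "0 \<le> a * (u - 1)\<^sup>2" using assms by simp
    then show ?thesis using assms by (simp add: power2_eq_square algebra_simps)
  qed
  ultimately have "a * u \<le> exp (a * u\<^sup>2 / 2)" by linarith
  then have "a * u * E \<le> exp (a * u\<^sup>2 / 2) * E"
    using E by (intro mult_right_mono)
  also have "\<dots> = 1" by (simp add: E_def exp_add[symmetric])
  finally have "a * u * E \<le> 1" .
  moreover have "a * E \<le> 1" using E assms by (simp add: mult_le_one)
  ultimately have "a * ((1 + u) * E) \<le> 2" by (simp add: algebra_simps)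
  then show ?thesis using assms by (simp add: E_def field_simps)
qed

lemma gauss_interval_le_tail_powr:
  assumes a: "0 < a" "a \<le> 1" and s: "0 \<le> s"
  shows "std_normal.prob {y<..<y + s} \<le> 6 / a * s powr (1 - a) * gauss_tail y powr (1 - a)"
proof -
  define u where "u = max y 0"
  define F where "F = gauss_tail y"
  define A where "A = std_normal.prob {y<..<y + s}"
  define c where "c = exp 1 * (1 + u)"
  have u: "0 \<le> u" by (simp add: u_def)
  have F: "0 < F" "F \<le> 1" by (simp_all add: F_def gauss_tail_pos gauss_tail_le_1)
  have "(1::real) \<le> exp 1" by simp
  then have c: "1 \<le> c" using u mult_mono[of 1 "exp 1" 1 "1 + u"] by (simp add: c_def)
  have A0: "0 \<le> A" by (simp add: A_def)
  have AF: "A \<le> F"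
    unfolding A_def F_def gauss_tail_def by (intro std_normal.finite_measure_mono) auto
  have "A \<le> std_normal_density u * (y + s - y)"
    unfolding A_def u_def using s
    by (intro std_normal_interval_le std_normal_density_le_max0) auto
  also have "\<dots> \<le> c * F * s"
    using gauss_hazard_rate_le[of y] s by (simp add: u_def c_def F_def mult_right_mono)
  finally have As: "A \<le> c * F * s" .
  \<comment> \<open>Interpolation: the tail bound receives weight \<open>a\<close>, the hazard rate
    bound weight \<open>1 - a\<close>. The factor \<open>F powr a\<close> from the first supplies
    the Gaussian decay that compensates \<open>c\<close>.\<close>
  have "A = A powr a * A powr (1 - a)"
    using A0 by (simp add: powr_add[symmetric])
  also have "\<dots> \<le> F powr a * (c * F * s) powr (1 - a)"
    using A0 AF As a by (intro mult_mono powr_mono2) auto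
  also have "\<dots> = (c powr (1 - a) * F powr a) * (s powr (1 - a) * F powr (1 - a))"
    using c F s by (simp add: powr_mult)
  also have "\<dots> \<le> (c * exp (- a * u\<^sup>2 / 2)) * (s powr (1 - a) * F powr (1 - a))"
  proof (intro mult_right_mono mult_mono)
    show "c powr (1 - a) \<le> c"
      using c a powr_mono[of "1 - a" 1 c] by simp
    have "F powr a \<le> exp (- u\<^sup>2 / 2) powr a"
      using F a gauss_tail_le_exp[of y] by (intro powr_mono2) (auto simp: F_def u_def)
    also have "\<dots> = exp (- a * u\<^sup>2 / 2)"
      by (simp add: powr_def)
    finally show "F powr a \<le> exp (- a * u\<^sup>2 / 2)" .
  qed (use c in auto)
  also have "c * exp (- a * u\<^sup>2 / 2) \<le> 6 / a"
  proof -
    have "c * exp (- a * u\<^sup>2 / 2) \<le> exp 1 * (2 / a)"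
      unfolding c_def mult.assoc
      using one_plus_mult_exp_le[OF a u] by (intro mult_left_mono) auto
    \<comment> \<open>The constant 6 is 2 from \<open>one_plus_mult_exp_le\<close> times the upper
      bound 3 for \<open>exp 1\<close>.\<close>
    also have "\<dots> \<le> 3 * (2 / a)"
      using exp_le a by (intro mult_right_mono) auto
    finally show ?thesis by simp
  qed
  finally show ?thesis
    by (simp add: A_def F_def mult.assoc mult_right_mono)
qed

subsection \<open>The smoothed potential and its gradient\<close>

definition perturbed_max :: "real \<Rightarrow> real ^ 'n::finite \<Rightarrow> ('n \<Rightarrow> real) \<Rightarrow> real" where
  "perturbed_max eta G x = Max (range (\<lambda>i. G $ i + eta * x i))"

text \<open>Strict inequalities make these sets disjoint for different arms; they cover the space
  only up to ties.\<close>

definition lead_set :: "real \<Rightarrow> real ^ 'n::finite \<Rightarrow> 'n \<Rightarrow> ('n \<Rightarrow> real) set" where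
  "lead_set eta G i = {x. \<forall>j. j \<noteq> i \<longrightarrow> G $ j + eta * x j < G $ i + eta * x i}"

definition lead_prob :: "real \<Rightarrow> real ^ 'n::finite \<Rightarrow> 'n \<Rightarrow> real" where
  "lead_prob eta G i = std_normal_prod.prob (lead_set eta G i)"

text \<open>The part of the lead set where lowering arm \<open>i\<close> by \<open>s\<close> puts
  some rival strictly ahead of it.\<close>

definition near_set :: "real \<Rightarrow> real ^ 'n::finite \<Rightarrow> 'n \<Rightarrow> real \<Rightarrow> ('n \<Rightarrow> real) set" where
  "near_set eta G i s =
     {x \<in> lead_set eta G i. \<exists>j. j \<noteq> i \<and> G $ i + eta * x i - s < G $ j + eta * x j}"

lemma perturbed_max_ge: "G $ i + eta * x i \<le> perturbed_max eta G x"
  unfolding perturbed_max_def by (rule Max_ge) auto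

lemma perturbed_max_leI:
  assumes "\<And>i. G $ i + eta * x i \<le> c"
  shows "perturbed_max eta G x \<le> c"
  unfolding perturbed_max_def by (subst Max_le_iff) (auto simp: assms)

lemma perturbed_max_lead_set:
  assumes "x \<in> lead_set eta G i"
  shows "perturbed_max eta G x = G $ i + eta * x i"
proof (rule antisym)
  show "perturbed_max eta G x \<le> G $ i + eta * x i"
  proof (rule perturbed_max_leI)
    fix j show "G $ j + eta * x j \<le> G $ i + eta * x i"
      using assms by (cases "j = i") (auto simp: lead_set_def less_imp_le)
  qed
qed (rule perturbed_max_ge)

text \<open>Every competing term moves by at most the norm of the shift. The bound is uniform in
  \<open>x\<close> and later dominates the difference quotients.\<close>

lemma perturbed_max_lipschitz:
  fixes G H :: "real ^ 'n::finite"
  shows "\<bar>perturbed_max eta G x - perturbed_max eta H x\<bar> \<le> norm (G - H)"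
proof -
  have *: "perturbed_max eta G x \<le> perturbed_max eta H x + norm (G - H)" for G H :: "real ^ 'n"
  proof (rule perturbed_max_leI)
    fix i
    have "G $ i - H $ i \<le> norm (G - H)"
      using component_le_norm_cart[of "G - H" i] by simp
    then show "G $ i + eta * x i \<le> perturbed_max eta H x + norm (G - H)"
      using perturbed_max_ge[of H i eta x] by simp
  qed
  show ?thesis
    using *[of G H] *[of H G] by (simp add: abs_le_iff norm_minus_commute)
qed

lemma measurable_perturbed_max [measurable]:
  "perturbed_max eta G \<in> borel_measurable std_normal_prod"
  unfolding perturbed_max_def[abs_def] by measurable

lemma space_std_normal_prod [simp]: "space std_normal_prod = UNIV"
  by (auto simp: space_PiM)

lemma std_normal_prod_prob_UNIV [simp]: "std_normal_prod.prob UNIV = 1"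
  by (metis prob_space.prob_space prob_space_PiM prob_space_std_normal space_std_normal_prod)

lemma sets_lead_set [measurable]: "lead_set eta G i \<in> sets std_normal_prod"
proof -
  have "{x \<in> space std_normal_prod. \<forall>j. j \<noteq> i \<longrightarrow> G $ j + eta * x j < G $ i + eta * x i}
      \<in> sets std_normal_prod"
    by measurable
  then show ?thesis by (simp add: lead_set_def)
qed

lemma sets_near_set [measurable]: "near_set eta G i s \<in> sets std_normal_prod"
proof -
  have "{x \<in> space std_normal_prod. x \<in> lead_set eta G i \<and>
      (\<exists>j. j \<noteq> i \<and> G $ i + eta * x i - s < G $ j + eta * x j)} \<in> sets std_normal_prod"
    by measurable
  then show ?thesis by (simp add: near_set_def)
qed

section \<open>Marginals and integrability of the perturbed maximum\<close>

lemma distr_std_normal_prod_component: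
  "distr std_normal_prod borel (\<lambda>x. x i) = std_normal"
proof -
  have "distr std_normal_prod borel (\<lambda>x. x i) = distr std_normal_prod std_normal (\<lambda>x. x i)"
    by (intro distr_cong) auto
  then show ?thesis
    using std_normal_prod.PiM_component[of i] by simp
qed

lemma integrable_std_normal_prod_component:
  fixes f :: "real \<Rightarrow> real"
  assumes "integrable std_normal f"
  shows "integrable std_normal_prod (\<lambda>x. f (x i))"
proof -
  have f: "f \<in> borel_measurable borel"
    using borel_measurable_integrable[OF assms] by simp
  have "integrable (distr std_normal_prod borel (\<lambda>x. x i)) f"
    using assms by (simp only: distr_std_normal_prod_component)
  then show ?thesis
    using f by (subst (asm) integrable_distr_eq) auto
qed

lemma integral_std_normal_prod_component:
  fixes f :: "real \<Rightarrow> real"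
  assumes "f \<in> borel_measurable borel"
  shows "(\<integral>x. f (x i) \<partial>std_normal_prod) = (\<integral>z. f z \<partial>std_normal)"
proof -
  have "(\<integral>x. f (x i) \<partial>std_normal_prod) = (\<integral>z. f z \<partial>distr std_normal_prod borel (\<lambda>x. x i))"
    using assms by (subst integral_distr) auto
  then show ?thesis by (simp only: distr_std_normal_prod_component)
qed

lemma integrable_perturbed_max:
  fixes G :: "real ^ 'n::finite"
  shows "integrable std_normal_prod (perturbed_max eta G)"
proof (rule Bochner_Integration.integrable_bound)
  show "integrable std_normal_prod (\<lambda>x. \<Sum>i\<in>UNIV. \<bar>G $ i\<bar> + \<bar>eta\<bar> * \<bar>x i\<bar>)"
    by (intro Bochner_Integration.integrable_sum Bochner_Integration.integrable_add
          integrable_mult_right std_normal_prod.integrable_const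
          integrable_std_normal_prod_component[of "\<lambda>z. \<bar>z\<bar>"] integrable_abs
          integrable_std_normal_id)
  show "AE x in std_normal_prod. norm (perturbed_max eta G x)
      \<le> norm (\<Sum>i\<in>UNIV. \<bar>G $ i\<bar> + \<bar>eta\<bar> * \<bar>x i\<bar>)"
  proof (rule AE_I2)
    fix x :: "'n \<Rightarrow> real"
    have "perturbed_max eta G x \<in> range (\<lambda>i. G $ i + eta * x i)"
      unfolding perturbed_max_def by (rule Max_in) auto
    then obtain i where i: "perturbed_max eta G x = G $ i + eta * x i" by auto
    have "\<bar>G $ i + eta * x i\<bar> \<le> \<bar>G $ i\<bar> + \<bar>eta\<bar> * \<bar>x i\<bar>"
      by (metis abs_mult abs_triangle_ineq)
    also have "\<dots> \<le> (\<Sum>i\<in>UNIV. \<bar>G $ i\<bar> + \<bar>eta\<bar> * \<bar>x i\<bar>)"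
      by (rule member_le_sum) auto
    finally show "norm (perturbed_max eta G x) \<le> norm (\<Sum>i\<in>UNIV. \<bar>G $ i\<bar> + \<bar>eta\<bar> * \<bar>x i\<bar>)"
      by (simp add: i)
  qed
qed measurable

lemma measurable_vec_lambda_std_normal_prod [measurable]:
  "(vec_lambda :: ('n::finite \<Rightarrow> real) \<Rightarrow> _) \<in> borel_measurable std_normal_prod"
  using measurable_vec_lambda_PiM by (simp cong: measurable_cong_sets sets_PiM_cong)

lemma gauss_smoothed_potential_eq:
  "gauss_smoothed_potential eta G = (\<integral>x. perturbed_max eta G x \<partial>std_normal_prod)"
  unfolding gauss_smoothed_potential_def std_gauss_vec_eq_distr perturbed_max_def
  by (subst integral_distr) auto

text \<open>The maximum dominates arm \<open>i\<close>, whose perturbation has mean zero.\<close>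

lemma gauss_smoothed_potential_ge: "G $ i \<le> gauss_smoothed_potential eta G"
proof -
  have int: "integrable std_normal_prod (\<lambda>x. x i)"
    by (rule integrable_std_normal_prod_component[OF integrable_std_normal_id])
  have "G $ i = (\<integral>x. G $ i + eta * x i \<partial>std_normal_prod)"
    using int integral_std_normal_prod_component[of "\<lambda>z. z" i]
    by (simp add: integral_std_normal_id)
  also have "\<dots> \<le> gauss_smoothed_potential eta G"
    unfolding gauss_smoothed_potential_eq using int
    by (intro integral_mono integrable_perturbed_max perturbed_max_ge) auto
  finally show ?thesis .
qed

text \<open>A tie confines the perturbation vector to a hyperplane, which is Lebesgue null, and the
  Gaussian vector has a Lebesgue density.\<close>

lemma AE_std_normal_prod_no_tie:
  assumes "eta \<noteq> 0" "i \<noteq> j"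
  shows "AE x in std_normal_prod. G $ i + eta * x i \<noteq> G $ j + eta * x (j::'n::finite)"
proof -
  define a :: "real ^ 'n" where "a = axis i 1 - axis j 1"
  define b where "b = (G $ j - G $ i) / eta"
  have "a $ i = 1" using assms by (simp add: a_def axis_def)
  then have "a \<noteq> 0" by auto
  then have "negligible {w. a \<bullet> w = b}"
    by (intro negligible_hyperplane) auto
  then have "{w. a \<bullet> w = b} \<in> null_sets lebesgue"
    by (simp add: negligible_iff_null_sets)
  moreover have "{w. a \<bullet> w = b} \<in> sets borel"
    by measurable
  ultimately have "AE w in lborel. a \<bullet> w \<noteq> b"
    by (auto intro!: AE_I'[of "{w. a \<bullet> w = b}"] simp: null_sets_completion_iff)
  then have "AE w in std_gauss_vec. a \<bullet> w \<noteq> b"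
    unfolding std_gauss_vec_def by (subst AE_density) auto
  then have "AE x in std_normal_prod. a \<bullet> vec_lambda x \<noteq> b"
    unfolding std_gauss_vec_eq_distr by (subst (asm) AE_distr_iff) auto
  then show ?thesis
    by eventually_elim
       (use assms in \<open>auto simp: a_def b_def inner_diff_left inner_axis' field_simps\<close>)
qed

lemma AE_lead_set:
  assumes "eta \<noteq> 0"
  shows "AE x in std_normal_prod. \<exists>i. x \<in> lead_set eta G (i::'n::finite)"
proof -
  have "AE x in std_normal_prod. \<forall>p. fst p \<noteq> snd p \<longrightarrow>
      G $ fst p + eta * x (fst p) \<noteq> G $ snd p + eta * x (snd p :: 'n)"
    using assms by (intro eventually_all_finite) (auto intro: AE_std_normal_prod_no_tie)
  then show ?thesis
  proof eventually_elim
    case (elim x)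
    have "perturbed_max eta G x \<in> range (\<lambda>i. G $ i + eta * x i)"
      unfolding perturbed_max_def by (rule Max_in) auto
    then obtain i where "perturbed_max eta G x = G $ i + eta * x i" by auto
    then have "x \<in> lead_set eta G i"
      using elim perturbed_max_ge[of G _ eta x] by (fastforce simp: lead_set_def less_le)
    then show ?case ..
  qed
qed

section \<open>Leading probabilities as the gradient of the potential\<close>

lemma lead_set_disjoint: "x \<in> lead_set eta G i \<Longrightarrow> x \<in> lead_set eta G j \<Longrightarrow> i = j"
  by (force simp: lead_set_def)

lemma sum_lead_set:
  fixes f :: "'n::finite \<Rightarrow> real"
  assumes "x \<in> lead_set eta G i"
  shows "(\<Sum>j\<in>UNIV. f j * indicator (lead_set eta G j) x) = f i"
proof -
  have "(\<Sum>j\<in>UNIV. f j * indicator (lead_set eta G j) x) = (\<Sum>j\<in>UNIV. if j = i then f j else 0)"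
    using assms by (intro sum.cong) (auto simp: indicator_def dest: lead_set_disjoint)
  then show ?thesis by simp
qed

lemma sum_lead_prob:
  fixes G :: "real ^ 'n::finite"
  assumes "eta \<noteq> 0"
  shows "(\<Sum>i\<in>UNIV. lead_prob eta G i) = 1"
proof -
  have "(\<Sum>i\<in>UNIV. lead_prob eta G i)
      = (\<integral>x. (\<Sum>i\<in>UNIV. 1 * indicator (lead_set eta G i) x) \<partial>std_normal_prod)"
    by (simp add: lead_prob_def std_normal_prod.emeasure_eq_measure)
  also have "\<dots> = (\<integral>x. 1 \<partial>(std_normal_prod :: ('n \<Rightarrow> real) measure))"
  proof (rule integral_cong_AE)
    show "AE x in std_normal_prod. (\<Sum>i\<in>UNIV. 1 * indicator (lead_set eta G i) x) = (1::real)"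
      using AE_lead_set[OF assms, of G]
    proof eventually_elim
      case (elim x)
      then obtain i where "x \<in> lead_set eta G i" ..
      from sum_lead_set[OF this, of "\<lambda>_. 1"] show ?case .
    qed
  qed measurable
  finally show ?thesis by simp
qed

text \<open>Differentiation under the integral sign: for almost every \<open>x\<close> there is a
  unique leader, which keeps the lead for all points near \<open>G\<close>, so the perturbed maximum
  is locally linear in \<open>G\<close>. The passage to sequences allows dominated
  convergence.\<close>

lemma has_derivative_gauss_smoothed_potential:
  assumes "eta \<noteq> 0"
  shows "(gauss_smoothed_potential eta has_derivative
           (\<lambda>h. \<Sum>i\<in>UNIV. h $ i * lead_prob eta G i)) (at (G :: real ^ 'n::finite))"
  unfolding has_derivative_iff_norm
proof (intro conjI)
  show "bounded_linear (\<lambda>h. \<Sum>i\<in>UNIV. h $ i * lead_prob eta G i)"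
    by (intro bounded_linear_sum bounded_linear_mult_left[THEN bounded_linear_compose]
          bounded_linear_vec_nth)
  show "((\<lambda>y. norm (gauss_smoothed_potential eta y - gauss_smoothed_potential eta G
      - (\<Sum>i\<in>UNIV. (y - G) $ i * lead_prob eta G i)) / norm (y - G)) \<longlongrightarrow> 0) (at G)"
    unfolding tendsto_at_iff_sequentially
  proof (intro allI impI)
    fix X :: "nat \<Rightarrow> real ^ 'n"
    assume "\<forall>n. X n \<in> UNIV - {G}" and X: "X \<longlonglongrightarrow> G"
    then have ne: "norm (X n - G) > 0" for n by auto
    \<comment> \<open>The pointwise linearisation error, normalised by the size of the
      shift.\<close>
    define q where "q n x = (perturbed_max eta (X n) x - perturbed_max eta G x
      - (\<Sum>i\<in>UNIV. (X n - G) $ i * indicator (lead_set eta G i) x)) / norm (X n - G)" for n x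
    have q [measurable]: "q n \<in> borel_measurable std_normal_prod" for n
      unfolding q_def[abs_def] by measurable
    have "(\<lambda>n. \<integral>x. q n x \<partial>std_normal_prod) \<longlonglongrightarrow> (\<integral>x. 0 \<partial>(std_normal_prod :: ('n \<Rightarrow> real) measure))"
    \<comment> \<open>The dominating constant counts 1 for the Lipschitz bound of the maximum and 1
      for each summand of the linear part.\<close>
    proof (rule integral_dominated_convergence[where w = "\<lambda>_. 1 + real CARD('n)"])
      show "AE x in std_normal_prod. (\<lambda>n. q n x) \<longlonglongrightarrow> 0"
        using AE_lead_set[OF assms, of G]
      proof eventually_elim
        case (elim x)
        then obtain i where i: "x \<in> lead_set eta G i" ..
        have "eventually (\<lambda>n. \<forall>j. j \<noteq> i \<longrightarrow> X n $ j + eta * x j < X n $ i + eta * x i) sequentially"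
        proof (intro eventually_all_finite)
          fix j
          have *: "(\<lambda>n. (X n $ i + eta * x i) - (X n $ j + eta * x j))
              \<longlonglongrightarrow> (G $ i + eta * x i) - (G $ j + eta * x j)"
            by (intro tendsto_intros tendsto_vec_nth X)
          show "eventually (\<lambda>n. j \<noteq> i \<longrightarrow> X n $ j + eta * x j < X n $ i + eta * x i) sequentially"
          proof (cases "j = i")
            case False
            then have "0 < (G $ i + eta * x i) - (G $ j + eta * x j)"
              using i by (simp add: lead_set_def)
            from order_tendstoD(1)[OF * this] show ?thesis
              by eventually_elim simp
          qed simp
        qed
        then have "eventually (\<lambda>n. q n x = 0) sequentially"
        proof eventually_elim
          case (elim n)
          then have "x \<in> lead_set eta (X n) i" by (simp add: lead_set_def)
          then show ?case
            unfolding q_def sum_lead_set[OF i] using perturbed_max_lead_set[OF i]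
            by (simp add: perturbed_max_lead_set)
        qed
        then show ?case by (rule tendsto_eventually)
      qed
      fix n
      show "AE x in std_normal_prod. norm (q n x) \<le> 1 + real CARD('n)"
      proof (rule AE_I2)
        fix x :: "'n \<Rightarrow> real"
        have "\<bar>\<Sum>i\<in>UNIV. (X n - G) $ i * indicator (lead_set eta G i) x\<bar>
            \<le> (\<Sum>i\<in>(UNIV::'n set). norm (X n - G))"
        proof (rule sum_abs[THEN order_trans], rule sum_mono)
          fix i
          show "\<bar>(X n - G) $ i * indicator (lead_set eta G i) x\<bar> \<le> norm (X n - G)"
            using component_le_norm_cart[of "X n - G" i] by (auto simp: indicator_def)
        qed
        then have "\<bar>perturbed_max eta (X n) x - perturbed_max eta G x
            - (\<Sum>i\<in>UNIV. (X n - G) $ i * indicator (lead_set eta G i) x)\<bar>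
            \<le> (1 + real CARD('n)) * norm (X n - G)"
          using perturbed_max_lipschitz[of eta "X n" x G]
          by (simp add: algebra_simps abs_le_iff)
        then show "norm (q n x) \<le> 1 + real CARD('n)"
          using ne[of n] by (simp add: q_def divide_le_eq)
      qed
    qed auto
    moreover have "(\<integral>x. q n x \<partial>std_normal_prod) =
        (gauss_smoothed_potential eta (X n) - gauss_smoothed_potential eta G
      - (\<Sum>i\<in>UNIV. (X n - G) $ i * lead_prob eta G i)) / norm (X n - G)" for n
    proof -
      have int: "integrable std_normal_prod (\<lambda>x. (X n - G) $ i * indicator (lead_set eta G i) x)" for i
        by (intro integrable_mult_right) (simp add: std_normal_prod.emeasure_eq_measure)
      have "(\<integral>x. (\<Sum>i\<in>UNIV. (X n - G) $ i * indicator (lead_set eta G i) x) \<partial>std_normal_prod)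
          = (\<Sum>i\<in>UNIV. (X n - G) $ i * lead_prob eta G i)"
        by (subst Bochner_Integration.integral_sum[OF int]) (simp add: lead_prob_def)
      moreover have "integrable std_normal_prod
          (\<lambda>x. \<Sum>i\<in>UNIV. (X n - G) $ i * indicator (lead_set eta G i) x)"
        by (intro Bochner_Integration.integrable_sum int)
      ultimately show ?thesis
        unfolding q_def gauss_smoothed_potential_eq
        by (simp only: integral_divide_zero Bochner_Integration.integral_diff
              Bochner_Integration.integrable_diff integrable_perturbed_max)
    qed
    ultimately have "(\<lambda>n. (gauss_smoothed_potential eta (X n) - gauss_smoothed_potential eta G
      - (\<Sum>i\<in>UNIV. (X n - G) $ i * lead_prob eta G i)) / norm (X n - G)) \<longlonglongrightarrow> 0"
      by simp
    from tendsto_norm_zero[OF this]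
    show "((\<lambda>y. norm (gauss_smoothed_potential eta y - gauss_smoothed_potential eta G
      - (\<Sum>i\<in>UNIV. (y - G) $ i * lead_prob eta G i)) / norm (y - G)) \<circ> X) \<longlonglongrightarrow> 0"
      by (simp add: o_def)
  qed
qed

lemma grad_gauss_smoothed_potential:
  assumes "eta \<noteq> 0"
  shows "grad (gauss_smoothed_potential eta) G $ i = lead_prob eta G i"
proof -
  have "frechet_derivative (gauss_smoothed_potential eta) (at G)
      = (\<lambda>h. \<Sum>j\<in>UNIV. h $ j * lead_prob eta G j)"
    by (rule frechet_derivative_at[OF has_derivative_gauss_smoothed_potential[OF assms], symmetric])
  then show ?thesis
    by (simp add: grad_def axis_def if_distrib[where f = "\<lambda>c. c * _"] cong: if_cong)
qed

subsection \<open>Divergence of the smoothed potential\<close>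

text \<open>The threshold that the perturbation of arm \<open>i\<close> must exceed for
  \<open>i\<close> to lead. It does not involve \<open>x i\<close>, so it is a function of the other
  arms alone.\<close>

definition rival_level :: "real \<Rightarrow> real ^ 'n::finite \<Rightarrow> 'n \<Rightarrow> ('n \<Rightarrow> real) \<Rightarrow> real" where
  "rival_level eta G i x = (Max ((\<lambda>j. G $ j + eta * x j) ` (UNIV - {i})) - G $ i) / eta"

abbreviation std_normal_rest :: "'n::finite \<Rightarrow> ('n \<Rightarrow> real) measure" where
  "std_normal_rest i \<equiv> PiM (UNIV - {i}) (\<lambda>_. std_normal)"

lemma rival_slices:
  fixes i :: "'n::finite"
  assumes eta: "0 < eta" and N2: "2 \<le> CARD('n)"
  shows "x(i := z) \<in> lead_set eta G i \<longleftrightarrow> rival_level eta G i x < z"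
    and "x(i := z) \<in> near_set eta G i s \<longleftrightarrow>
           rival_level eta G i x < z \<and> z < rival_level eta G i x + s / eta"
proof -
  \<comment> \<open>Two arms guarantee a rival, so that \<open>Max\<close> ranges over a nonempty
    set.\<close>
  have ne: "UNIV - {i} \<noteq> {}"
  proof
    assume "UNIV - {i} = {}"
    then have "(UNIV :: 'n set) = {i}" by auto
    then have "CARD('n) = card {i}" by (rule arg_cong)
    then show False using N2 by simp
  qed
  define m where "m = Max ((\<lambda>j. G $ j + eta * x j) ` (UNIV - {i}))"
  have r: "rival_level eta G i x = (m - G $ i) / eta"
    by (simp add: rival_level_def m_def)
  have "x(i := z) \<in> lead_set eta G i \<longleftrightarrow> m < G $ i + eta * z"
    using ne unfolding m_def by (subst Max_less_iff) (auto simp: lead_set_def)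
  also have "\<dots> \<longleftrightarrow> rival_level eta G i x < z"
    using eta by (auto simp: r field_simps)
  finally show 1: "x(i := z) \<in> lead_set eta G i \<longleftrightarrow> rival_level eta G i x < z" .
  have "(\<exists>j. j \<noteq> i \<and> G $ i + eta * z - s < G $ j + eta * x j) \<longleftrightarrow> G $ i + eta * z - s < m"
    using ne unfolding m_def by (subst Max_gr_iff) auto
  also have "\<dots> \<longleftrightarrow> z < rival_level eta G i x + s / eta"
    using eta by (auto simp: r field_simps)
  finally have "(\<exists>j. j \<noteq> i \<and> G $ i + eta * z - s < G $ j + eta * x j)
      \<longleftrightarrow> z < rival_level eta G i x + s / eta" .
  moreover have "x(i := z) \<in> near_set eta G i s \<longleftrightarrow> x(i := z) \<in> lead_set eta G i \<and>
      (\<exists>j. j \<noteq> i \<and> G $ i + eta * z - s < G $ j + eta * x j)"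
    by (auto simp: near_set_def)
  ultimately show "x(i := z) \<in> near_set eta G i s \<longleftrightarrow>
      rival_level eta G i x < z \<and> z < rival_level eta G i x + s / eta"
    using 1 by blast
qed

text \<open>Fubini with coordinate \<open>i\<close> innermost: the inner integral is the Gaussian
  mass of the slice.\<close>

lemma emeasure_std_normal_prod_slices:
  fixes i :: "'n::finite"
  assumes S [measurable]: "S \<in> sets std_normal_prod"
    and slice: "\<And>x z. x(i := z) \<in> S \<longleftrightarrow> z \<in> A x"
    and A: "\<And>x. A x \<in> sets borel"
  shows "emeasure std_normal_prod S = (\<integral>\<^sup>+x. emeasure std_normal (A x) \<partial>std_normal_rest i)"
proof -
  have ins: "insert i (UNIV - {i}) = UNIV" by auto
  have "emeasure std_normal_prod S = (\<integral>\<^sup>+x. indicator S x \<partial>std_normal_prod)"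
    by simp
  also have "\<dots> = (\<integral>\<^sup>+x. \<integral>\<^sup>+z. indicator S (x(i := z)) \<partial>std_normal \<partial>std_normal_rest i)"
    using std_normal_prod.product_nn_integral_insert[of "UNIV - {i}" i "indicator S"]
    unfolding ins by simp
  also have "\<dots> = (\<integral>\<^sup>+x. \<integral>\<^sup>+z. indicator (A x) z \<partial>std_normal \<partial>std_normal_rest i)"
    by (simp add: indicator_def slice)
  also have "\<dots> = (\<integral>\<^sup>+x. emeasure std_normal (A x) \<partial>std_normal_rest i)"
    using A by simp
  finally show ?thesis .
qed

section \<open>Conditioning on the perturbations of the rivals\<close>

lemma measurable_gauss_tail [measurable]: "gauss_tail \<in> borel_measurable borel"
proof -
  have "(\<lambda>y. - gauss_tail y) \<in> borel_measurable borel"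
    by (intro borel_measurable_mono monoI) (simp add: gauss_tail_antimono)
  then show ?thesis by simp
qed

lemma measurable_rival_level [measurable]:
  "rival_level eta G i \<in> borel_measurable (std_normal_rest i)"
  unfolding rival_level_def[abs_def] by measurable

lemma lead_prob_eq_tail:
  fixes G :: "real ^ 'n::finite"
  assumes "0 < eta" "2 \<le> CARD('n)"
  shows "ennreal (lead_prob eta G i)
           = (\<integral>\<^sup>+x. ennreal (gauss_tail (rival_level eta G i x)) \<partial>std_normal_rest i)"
proof -
  have "ennreal (lead_prob eta G i) = emeasure std_normal_prod (lead_set eta G i)"
    by (simp add: lead_prob_def std_normal_prod.emeasure_eq_measure)
  also have "\<dots> = (\<integral>\<^sup>+x. emeasure std_normal {rival_level eta G i x<..} \<partial>std_normal_rest i)"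
    by (rule emeasure_std_normal_prod_slices) (auto simp: rival_slices[OF assms])
  finally show ?thesis
    by (simp add: gauss_tail_def std_normal.emeasure_eq_measure)
qed

text \<open>The conditional probability of leading is a Gaussian tail and hence positive everywhere,
  so its mean cannot vanish. This keeps the importance weights finite.\<close>

lemma lead_prob_pos:
  fixes G :: "real ^ 'n::finite"
  assumes "0 < eta" "2 \<le> CARD('n)"
  shows "0 < lead_prob eta G i"
proof (rule ccontr)
  interpret Q: prob_space "std_normal_rest i"
    by (intro prob_space_PiM prob_space_std_normal)
  assume "\<not> 0 < lead_prob eta G i"
  then have "(\<integral>\<^sup>+x. ennreal (gauss_tail (rival_level eta G i x)) \<partial>std_normal_rest i) = 0"
    using lead_prob_eq_tail[OF assms, of G i] by (simp add: ennreal_neg)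
  then have "AE x in std_normal_rest i. ennreal (gauss_tail (rival_level eta G i x)) = 0"
    by (subst (asm) nn_integral_0_iff_AE) auto
  then have "AE x in std_normal_rest i. False"
    by eventually_elim (metis ennreal_eq_0_iff gauss_tail_pos not_le)
  then show False by simp
qed

text \<open>Linearising the concave power at the mean \<open>p\<close> plays the role of Jensen's inequality
  for the expectation over the other arms.\<close>

lemma near_prob_le:
  fixes G :: "real ^ 'n::finite"
  assumes eta: "0 < eta" and N2: "2 \<le> CARD('n)" and a: "0 < a" "a \<le> 1" and s: "0 \<le> s"
  shows "std_normal_prod.prob (near_set eta G i s)
           \<le> 6 / a * (s / eta) powr (1 - a) * lead_prob eta G i powr (1 - a)"
proof -
  interpret Q: prob_space "std_normal_rest i"
    by (intro prob_space_PiM prob_space_std_normal)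
  define p where "p = lead_prob eta G i"
  define r where "r = rival_level eta G i"
  define K where "K = 6 / a * (s / eta) powr (1 - a) * p powr (1 - a)"
  have p: "0 < p" unfolding p_def by (rule lead_prob_pos[OF eta N2])
  have K: "0 \<le> K" using a by (simp add: K_def)
  have r [measurable]: "r \<in> borel_measurable (std_normal_rest i)"
    by (simp add: r_def)
  have young: "F powr (1 - a) \<le> p powr (1 - a) * ((1 - a) / p * F + a)" if "0 < F" for F
  proof -
    have "F powr (1 - a) = p powr (1 - a) * ((F / p) powr (1 - a) * 1 powr a)"
      using p that by (simp add: powr_divide)
    also have "\<dots> \<le> p powr (1 - a) * ((1 - a) * (F / p) + a * 1)"
      using p that a by (intro mult_left_mono Youngs_inequality_0) auto
    finally show ?thesis by simp
  qed
  have slice: "std_normal.prob {r x<..<r x + s / eta}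
      \<le> K * ((1 - a) / p * gauss_tail (r x) + a)" for x
  proof -
    have "std_normal.prob {r x<..<r x + s / eta}
        \<le> 6 / a * (s / eta) powr (1 - a) * gauss_tail (r x) powr (1 - a)"
      using eta s a by (intro gauss_interval_le_tail_powr) auto
    also have "\<dots> \<le> 6 / a * (s / eta) powr (1 - a)
        * (p powr (1 - a) * ((1 - a) / p * gauss_tail (r x) + a))"
      using a by (intro mult_left_mono young gauss_tail_pos) auto
    finally show ?thesis by (simp add: K_def mult.assoc)
  qed
  have "emeasure std_normal_prod (near_set eta G i s)
      = (\<integral>\<^sup>+x. emeasure std_normal {r x<..<r x + s / eta} \<partial>std_normal_rest i)"
    by (rule emeasure_std_normal_prod_slices) (auto simp: rival_slices[OF eta N2] r_def)
  also have "\<dots> \<le> (\<integral>\<^sup>+x. ennreal (K * (1 - a) / p) * ennreal (gauss_tail (r x)) + ennreal (K * a)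
      \<partial>std_normal_rest i)"
  proof (rule nn_integral_mono)
    fix x
    have "emeasure std_normal {r x<..<r x + s / eta}
        \<le> ennreal (K * ((1 - a) / p * gauss_tail (r x) + a))"
      using slice[of x] by (simp add: std_normal.emeasure_eq_measure ennreal_leI)
    also have "K * ((1 - a) / p * gauss_tail (r x) + a)
        = K * (1 - a) / p * gauss_tail (r x) + K * a"
      by (simp add: algebra_simps)
    also have "ennreal \<dots> = ennreal (K * (1 - a) / p * gauss_tail (r x)) + ennreal (K * a)"
      using K a p gauss_tail_pos[of "r x"] by (intro ennreal_plus) auto
    also have "ennreal (K * (1 - a) / p * gauss_tail (r x))
        = ennreal (K * (1 - a) / p) * ennreal (gauss_tail (r x))"
      using K a p gauss_tail_pos[of "r x"] by (intro ennreal_mult) auto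
    finally show "emeasure std_normal {r x<..<r x + s / eta}
        \<le> ennreal (K * (1 - a) / p) * ennreal (gauss_tail (r x)) + ennreal (K * a)" .
  qed
  \<comment> \<open>The tail averages to \<open>p\<close>, and therefore the affine bound averages
    to exactly \<open>K\<close>.\<close>
  also have "\<dots> = ennreal (K * (1 - a) / p) * ennreal p + ennreal (K * a)"
    using lead_prob_eq_tail[OF eta N2, of G i]
    by (simp add: nn_integral_add nn_integral_cmult Q.emeasure_space_1 p_def r_def)
  also have "\<dots> = ennreal (K * (1 - a) / p * p + K * a)"
    using K a p by (subst ennreal_plus) (auto simp: ennreal_mult[symmetric])
  also have "K * (1 - a) / p * p + K * a = K"
    using p by (simp add: right_diff_distrib)
  finally show ?thesis
    using K by (simp add: std_normal_prod.emeasure_eq_measure K_def p_def)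
qed

text \<open>Lowering arm \<open>i\<close> never raises the maximum, and it lowers it by
  \<open>s\<close> wherever \<open>i\<close> leads by at least \<open>s\<close>. On
  \<open>near_set\<close> the two indicator terms cancel and monotonicity alone suffices.\<close>

lemma gauss_smoothed_potential_step:
  fixes G :: "real ^ 'n::finite"
  assumes "0 \<le> s"
  shows "gauss_smoothed_potential eta (G - s *\<^sub>R axis i 1)
           \<le> gauss_smoothed_potential eta G - s * lead_prob eta G i
             + s * std_normal_prod.prob (near_set eta G i s)"
proof -
  let ?H = "G - s *\<^sub>R axis i 1"
  have "gauss_smoothed_potential eta ?H
      \<le> (\<integral>x. perturbed_max eta G x - s * indicator (lead_set eta G i) x
            + s * indicator (near_set eta G i s) x \<partial>std_normal_prod)"
    unfolding gauss_smoothed_potential_eq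
  proof (rule integral_mono)
    show "integrable std_normal_prod (perturbed_max eta ?H)"
      by (rule integrable_perturbed_max)
    show "integrable std_normal_prod (\<lambda>x. perturbed_max eta G x - s * indicator (lead_set eta G i) x
            + s * indicator (near_set eta G i s) x)"
      by (intro Bochner_Integration.integrable_add Bochner_Integration.integrable_diff
            integrable_perturbed_max integrable_mult_right)
         (simp_all add: std_normal_prod.emeasure_eq_measure)
    fix x :: "'n \<Rightarrow> real"
    have H: "?H $ j = (if j = i then G $ i - s else G $ j)" for j
      by (simp add: axis_def)
    have mono: "perturbed_max eta ?H x \<le> perturbed_max eta G x"
    proof (rule perturbed_max_leI)
      fix j
      show "?H $ j + eta * x j \<le> perturbed_max eta G x"
        unfolding H using perturbed_max_ge[of G j eta x] assms by auto
    qed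
    show "perturbed_max eta ?H x \<le> perturbed_max eta G x - s * indicator (lead_set eta G i) x
            + s * indicator (near_set eta G i s) x"
    proof (cases "x \<in> lead_set eta G i \<and> x \<notin> near_set eta G i s")
      case True
      then have "G $ j + eta * x j \<le> G $ i + eta * x i - s" if "j \<noteq> i" for j
        using that by (auto simp: near_set_def not_less)
      then have "perturbed_max eta ?H x \<le> G $ i + eta * x i - s"
        by (intro perturbed_max_leI) (auto simp only: H split: if_split)
      then show ?thesis using True perturbed_max_lead_set[of x eta G i] by simp
    next
      case False
      then show ?thesis using mono assms by (auto simp: indicator_def near_set_def)
    qed
  qed
  also have "\<dots> = gauss_smoothed_potential eta G - s * lead_prob eta G i
             + s * std_normal_prod.prob (near_set eta G i s)"
    by (simp add: gauss_smoothed_potential_eq lead_prob_def integrable_perturbed_max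
          std_normal_prod.emeasure_eq_measure)
  finally show ?thesis .
qed

text \<open>Takes the step to be the importance-weighted loss \<open>c / p\<close>, with first-order
  effect \<open>c\<close>. The remainder has order \<open>1 / p\<close>, which the sampling
  probability \<open>p\<close> cancels on averaging.\<close>

lemma gauss_smoothed_potential_divergence:
  fixes G :: "real ^ 'n::finite"
  assumes eta: "0 < eta" and N2: "2 \<le> CARD('n)" and a: "0 < a" "a \<le> 1"
    and c: "0 \<le> c" "c \<le> 1"
  shows "gauss_smoothed_potential eta (G - (c / lead_prob eta G i) *\<^sub>R axis i 1)
           \<le> gauss_smoothed_potential eta G - c + 6 / a * eta powr (a - 1) / lead_prob eta G i"
proof -
  define p where "p = lead_prob eta G i"
  have p: "0 < p" unfolding p_def by (rule lead_prob_pos[OF eta N2])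
  have s: "0 \<le> c / p" "c / p \<le> 1 / p" using p c by (auto simp: divide_right_mono)
  have s': "0 \<le> c / p / eta" "c / p / eta \<le> 1 / p / eta"
    by (intro divide_nonneg_pos s eta, intro divide_right_mono s less_imp_le[OF eta])
  have "gauss_smoothed_potential eta (G - (c / p) *\<^sub>R axis i 1)
      \<le> gauss_smoothed_potential eta G - c / p * p + c / p * std_normal_prod.prob (near_set eta G i (c / p))"
    unfolding p_def using s by (intro gauss_smoothed_potential_step) (simp add: p_def)
  also have "c / p * p = c" using p by simp
  also have "c / p * std_normal_prod.prob (near_set eta G i (c / p))
      \<le> 1 / p * (6 / a * (1 / p / eta) powr (1 - a) * p powr (1 - a))"
  proof (rule mult_mono)
    have "std_normal_prod.prob (near_set eta G i (c / p))
        \<le> 6 / a * (c / p / eta) powr (1 - a) * p powr (1 - a)"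
      unfolding p_def using s by (intro near_prob_le eta N2 a) (simp add: p_def)
    also have "\<dots> \<le> 6 / a * (1 / p / eta) powr (1 - a) * p powr (1 - a)"
      using a by (intro mult_right_mono mult_left_mono powr_mono2 s') auto
    finally show "std_normal_prod.prob (near_set eta G i (c / p))
      \<le> 6 / a * (1 / p / eta) powr (1 - a) * p powr (1 - a)" .
  qed (use s p in auto)
  \<comment> \<open>The powers of \<open>p\<close> with exponent \<open>1 - a\<close> cancel, and
    only the factor \<open>1 / p\<close> from the step size survives.\<close>
  also have "1 / p * (6 / a * (1 / p / eta) powr (1 - a) * p powr (1 - a))
      = 6 / a * eta powr (a - 1) / p"
  proof -
    have "(1 / p / eta) powr (1 - a) * p powr (1 - a) = (1 / eta) powr (1 - a)"
      using p eta by (subst powr_mult[symmetric]) auto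
    also have "\<dots> = eta powr (- (1 - a))"
      using eta by (simp only: powr_minus_divide powr_divide powr_one_eq_one)
    finally show ?thesis by (simp only: mult.assoc) simp
  qed
  finally show ?thesis
    by (simp add: p_def)
qed

text \<open>The tangent inequality \<open>1 + z \<le> exp z\<close> at
  \<open>z = l * x i - l\<^sup>2\<close>, with the exponential enlarged to a sum over all arms,
  bounds every arm at once. The choice \<open>l\<^sup>2 = 2 * ln N\<close> gives the exponential sum
  mean one, so the bound integrates to \<open>eta * l\<close>.\<close>

lemma gauss_smoothed_potential_zero_le:
  assumes eta: "0 \<le> eta" and N2: "2 \<le> CARD('n)"
  shows "gauss_smoothed_potential eta (0 :: real ^ 'n::finite) \<le> eta * sqrt (2 * ln (real CARD('n)))"
proof -
  define l where "l = sqrt (2 * ln (real CARD('n)))"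
  have l: "0 < l" "l\<^sup>2 = 2 * ln (real CARD('n))" using N2 by (auto simp: l_def)
  have int0: "integrable std_normal_prod (\<lambda>x :: 'n \<Rightarrow> real. \<Sum>j\<in>UNIV. exp (l * x j))"
    by (intro Bochner_Integration.integrable_sum
          integrable_std_normal_prod_component[of "\<lambda>z. exp (l * z)"] integrable_std_normal_exp)
  then have int: "integrable std_normal_prod (\<lambda>x :: 'n \<Rightarrow> real. exp (- l\<^sup>2) * (\<Sum>j\<in>UNIV. exp (l * x j)))"
    by (rule integrable_mult_right)
  have "gauss_smoothed_potential eta (0 :: real ^ 'n)
      \<le> (\<integral>x. eta / l * (exp (- l\<^sup>2) * (\<Sum>j\<in>(UNIV::'n set). exp (l * x j)) + (l\<^sup>2 - 1)) \<partial>std_normal_prod)"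
    unfolding gauss_smoothed_potential_eq
  proof (rule integral_mono)
    show "integrable std_normal_prod (\<lambda>x. eta / l * (exp (- l\<^sup>2) * (\<Sum>j\<in>(UNIV::'n set). exp (l * x j)) + (l\<^sup>2 - 1)))"
      by (intro integrable_mult_right Bochner_Integration.integrable_add int0
          std_normal_prod.integrable_const)
    fix x :: "'n \<Rightarrow> real"
    show "perturbed_max eta 0 x \<le> eta / l * (exp (- l\<^sup>2) * (\<Sum>j\<in>(UNIV::'n set). exp (l * x j)) + (l\<^sup>2 - 1))"
    proof (rule perturbed_max_leI)
      fix i
      have "exp (l * x i) \<le> (\<Sum>j\<in>(UNIV::'n set). exp (l * x j))"
        by (rule member_le_sum) auto
      then have "exp (- l\<^sup>2) * exp (l * x i) \<le> exp (- l\<^sup>2) * (\<Sum>j\<in>(UNIV::'n set). exp (l * x j))"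
        by (intro mult_left_mono) auto
      moreover have "1 + (- l\<^sup>2 + l * x i) \<le> exp (- l\<^sup>2) * exp (l * x i)"
        using exp_ge_add_one_self[of "- l\<^sup>2 + l * x i"] by (simp only: exp_add)
      ultimately have "l * x i \<le> exp (- l\<^sup>2) * (\<Sum>j\<in>(UNIV::'n set). exp (l * x j)) + (l\<^sup>2 - 1)"
        by linarith
      then have "eta / l * (l * x i) \<le> eta / l * (exp (- l\<^sup>2) * (\<Sum>j\<in>(UNIV::'n set). exp (l * x j)) + (l\<^sup>2 - 1))"
        using eta l by (intro mult_left_mono) auto
      then show "0 $ i + eta * x i \<le> eta / l * (exp (- l\<^sup>2) * (\<Sum>j\<in>(UNIV::'n set). exp (l * x j)) + (l\<^sup>2 - 1))"
        using l by simp
    qed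
  qed (rule integrable_perturbed_max)
  also have "\<dots> = eta / l * (exp (- l\<^sup>2) * (real CARD('n) * exp (l\<^sup>2 / 2)) + (l\<^sup>2 - 1))"
  proof -
    have "(\<integral>x. (\<Sum>j\<in>(UNIV::'n set). exp (l * x j)) \<partial>std_normal_prod) = real CARD('n) * exp (l\<^sup>2 / 2)"
      using integral_std_normal_prod_component[of "\<lambda>z. exp (l * z)" "_ :: 'n"]
      by (subst Bochner_Integration.integral_sum)
         (auto simp: integral_std_normal_exp
           intro: integrable_std_normal_prod_component[of "\<lambda>z. exp (l * z)"] integrable_std_normal_exp)
    then show ?thesis
      using int by (simp only: integral_mult_right_zero Bochner_Integration.integral_add
          std_normal_prod.integrable_const) simp
  qed
  also have "\<dots> = eta * l"
  proof -
    have "exp (l\<^sup>2 / 2) = real CARD('n)" using N2 by (simp add: l)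
    moreover have "exp (- l\<^sup>2) = 1 / (exp (l\<^sup>2 / 2) * exp (l\<^sup>2 / 2))"
      by (simp add: exp_add[symmetric] exp_minus field_simps)
    ultimately have "exp (- l\<^sup>2) * (real CARD('n) * exp (l\<^sup>2 / 2)) = 1"
      using N2 by simp
    then show ?thesis using l(1) by (simp only: power2_eq_square) simp
  qed
  finally show ?thesis by (simp add: l_def)
qed

subsection \<open>Regret of gradient-based prediction\<close>

lemma gbpa_Ghat_cong:
  assumes "\<And>t. t \<in> {1..k} \<Longrightarrow> h t = h' t"
  shows "gbpa_Ghat P g h k = gbpa_Ghat P g h' k"
  using assms
proof (induction k)
  case (Suc k)
  then have "gbpa_Ghat P g h k = gbpa_Ghat P g h' k" "h (Suc k) = h' (Suc k)" by auto
  then show ?case by simp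
qed simp

lemma gbpa_Ghat_upd [simp]:
  "k < t \<Longrightarrow> gbpa_Ghat P g (h(t := i)) k = gbpa_Ghat P g h k"
  by (rule gbpa_Ghat_cong) auto

lemma gbpa_path_prob_Suc_upd:
  "gbpa_path_prob P g (Suc k) (h(Suc k := i)) = gbpa_path_prob P g k h * P (gbpa_Ghat P g h k) $ i"
proof -
  have "(\<Prod>t\<in>{1..k}. P (gbpa_Ghat P g (h(Suc k := i)) (t - 1)) $ (h(Suc k := i)) t)
      = (\<Prod>t\<in>{1..k}. P (gbpa_Ghat P g h (t - 1)) $ h t)"
    by (rule prod.cong) auto
  then show ?thesis by (simp add: gbpa_path_prob_def)
qed

text \<open>Tower property: given the first \<open>k\<close> choices, the next arm is drawn from the
  distribution that \<open>P\<close> assigns to the current estimate.\<close>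

lemma sum_paths_Suc:
  fixes F :: "(nat \<Rightarrow> 'n::finite) \<Rightarrow> real"
  shows "(\<Sum>h\<in>{1..Suc k} \<rightarrow>\<^sub>E UNIV. gbpa_path_prob P g (Suc k) h * F h)
    = (\<Sum>h\<in>{1..k} \<rightarrow>\<^sub>E UNIV. gbpa_path_prob P g k h *
         (\<Sum>i\<in>UNIV. P (gbpa_Ghat P g h k) $ i * F (h(Suc k := i))))"
proof -
  have ins: "{1..Suc k} = insert (Suc k) {1..k}" by auto
  have inj: "inj_on (\<lambda>(y, h). h(Suc k := y)) ((UNIV :: 'n set) \<times> ({1..k} \<rightarrow>\<^sub>E UNIV))"
    by (rule inj_combinator) auto
  have "(\<Sum>h\<in>{1..Suc k} \<rightarrow>\<^sub>E UNIV. gbpa_path_prob P g (Suc k) h * F h)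
      = (\<Sum>(i, h)\<in>UNIV \<times> ({1..k} \<rightarrow>\<^sub>E UNIV).
           gbpa_path_prob P g (Suc k) (h(Suc k := i)) * F (h(Suc k := i)))"
    unfolding ins PiE_insert_eq by (subst sum.reindex[OF inj]) (simp add: case_prod_unfold)
  also have "\<dots> = (\<Sum>h\<in>{1..k} \<rightarrow>\<^sub>E UNIV. \<Sum>i\<in>UNIV.
           gbpa_path_prob P g (Suc k) (h(Suc k := i)) * F (h(Suc k := i)))"
    by (subst sum.cartesian_product[symmetric]) (rule sum.swap)
  finally show ?thesis
    by (simp only: gbpa_path_prob_Suc_upd sum_distrib_left mult.assoc)
qed

text \<open>The regret against the best arm plus the gap between the potential and that arm's
  estimated gain grows in conditional mean by at most \<open>CARD('n) * b\<close> per round.\<close>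

lemma gbpa_expected_regret_le:
  fixes Phi :: "real ^ 'n::finite \<Rightarrow> real" and g :: "nat \<Rightarrow> real ^ 'n"
  assumes Phi_ge: "\<And>G i. G $ i \<le> Phi G"
    and pos: "\<And>G i. 0 < grad Phi G $ i"
    and sum1: "\<And>G. (\<Sum>i\<in>UNIV. grad Phi G $ i) = 1"
    and div: "\<And>G i c. 0 \<le> c \<Longrightarrow> c \<le> 1 \<Longrightarrow>
       Phi (G - (c / grad Phi G $ i) *\<^sub>R axis i 1) \<le> Phi G - c + b / grad Phi G $ i"
    and gains: "\<And>t i. t \<in> {1..T} \<Longrightarrow> g t $ i \<in> {-1..0}"
  shows "gbpa_expected_regret Phi g T \<le> Phi 0 + real T * (real CARD('n) * b)"
proof -
  define P where "P = grad Phi"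
  define pp where "pp = gbpa_path_prob P g"
  define Gh where "Gh h k = gbpa_Ghat P g h k" for h k
  define H :: "nat \<Rightarrow> (nat \<Rightarrow> 'n) set" where "H k = ({1..k} \<rightarrow>\<^sub>E UNIV)" for k
  have pp0: "0 \<le> pp k h" for k h
    unfolding pp_def gbpa_path_prob_def P_def using pos by (intro prod_nonneg) (auto simp: less_imp_le)
  have sumH: "(\<Sum>h\<in>H (Suc k). pp (Suc k) h * F h)
      = (\<Sum>h\<in>H k. pp k h * (\<Sum>i\<in>UNIV. P (Gh h k) $ i * F (h(Suc k := i))))" for k F
    unfolding pp_def H_def Gh_def by (rule sum_paths_Suc)
  have pp1: "(\<Sum>h\<in>H k. pp k h) = 1" for k
  proof (induction k)
    case 0
    show ?case by (simp add: H_def pp_def gbpa_path_prob_def)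
  next
    case (Suc k)
    then show ?case using sumH[of k "\<lambda>_. 1"] sum1 by (simp add: P_def)
  qed
  \<comment> \<open>The gains are fixed in advance, so one comparator \<open>i0\<close> is optimal
    on every path.\<close>
  obtain i0 where i0: "\<And>i. (\<Sum>t\<in>{1..T}. g t $ i) \<le> (\<Sum>t\<in>{1..T}. g t $ i0)"
  proof -
    have "Max (range (\<lambda>i. \<Sum>t\<in>{1..T}. g t $ i)) \<in> range (\<lambda>i. \<Sum>t\<in>{1..T}. g t $ i)"
      by (rule Max_in) auto
    then obtain i0 where i0: "Max (range (\<lambda>i. \<Sum>t\<in>{1..T}. g t $ i)) = (\<Sum>t\<in>{1..T}. g t $ i0)"
      by blast
    show ?thesis by (rule that[of i0], unfold i0[symmetric], rule Max_ge) auto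
  qed
  \<comment> \<open>At \<open>k = 0\<close> this equals \<open>Phi 0\<close>; at
    \<open>k = T\<close> it dominates the regret, because the potential dominates each
    coordinate.\<close>
  define U where "U k h = (\<Sum>t\<in>{1..k}. g t $ i0 - g t $ h t) + Phi (Gh h k) - Gh h k $ i0" for k h
  have step: "(\<Sum>i\<in>UNIV. P (Gh h k) $ i * U (Suc k) (h(Suc k := i)))
      \<le> U k h + real CARD('n) * b" if k: "Suc k \<in> {1..T}" for k h
  proof -
    define G where "G = Gh h k"
    define p where "p i = P G $ i" for i
    define \<gamma> where "\<gamma> = g (Suc k)"
    define R where "R = (\<Sum>t\<in>{1..k}. g t $ i0 - g t $ h t)"
    have p: "0 < p i" for i by (simp add: p_def P_def pos)
    have sp: "sum p UNIV = 1" using sum1[of G] by (simp add: p_def P_def)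
    have G': "Gh (h(Suc k := i)) (Suc k) = G + (\<gamma> $ i / p i) *\<^sub>R axis i 1" for i
      by (simp add: Gh_def G_def p_def \<gamma>_def)
    have R': "(\<Sum>t\<in>{1..Suc k}. g t $ i0 - g t $ (h(Suc k := i)) t) = R + (\<gamma> $ i0 - \<gamma> $ i)" for i
      by (simp add: R_def \<gamma>_def)
    have "p i * U (Suc k) (h(Suc k := i))
        \<le> p i * (R + \<gamma> $ i0 + Phi G - G $ i0) + b - (if i = i0 then \<gamma> $ i0 else 0)" for i
    proof -
      \<comment> \<open>Gains in [-1, 0] make \<open>c = - \<gamma> $ i\<close> an admissible loss
        for the divergence hypothesis.\<close>
      have "Phi (G - ((- \<gamma> $ i) / p i) *\<^sub>R axis i 1) \<le> Phi G - (- \<gamma> $ i) + b / p i"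
        unfolding p_def P_def using gains[OF k, of i] by (intro div) (auto simp: \<gamma>_def)
      then have "Phi (G + (\<gamma> $ i / p i) *\<^sub>R axis i 1) \<le> Phi G + \<gamma> $ i + b / p i"
        by simp
      then have "U (Suc k) (h(Suc k := i))
          \<le> (R + \<gamma> $ i0 + Phi G - G $ i0) + b / p i - (if i = i0 then \<gamma> $ i0 / p i else 0)"
        unfolding U_def R' G' by (auto simp: axis_def)
      then have "p i * U (Suc k) (h(Suc k := i))
          \<le> p i * ((R + \<gamma> $ i0 + Phi G - G $ i0) + b / p i - (if i = i0 then \<gamma> $ i0 / p i else 0))"
        using p[of i] by (intro mult_left_mono) auto
      also have "\<dots> = p i * (R + \<gamma> $ i0 + Phi G - G $ i0) + b - (if i = i0 then \<gamma> $ i0 else 0)"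
        using p[of i] p[of i0] by (simp add: distrib_left right_diff_distrib)
      finally show ?thesis .
    qed
    then have "(\<Sum>i\<in>UNIV. p i * U (Suc k) (h(Suc k := i)))
        \<le> (\<Sum>i\<in>UNIV. p i * (R + \<gamma> $ i0 + Phi G - G $ i0) + b - (if i = i0 then \<gamma> $ i0 else 0))"
      by (intro sum_mono)
    \<comment> \<open>The importance-weighted estimate is unbiased, so its mean
      \<open>\<gamma> $ i0\<close> cancels the comparator's gain. Each arm leaves one
      \<open>b\<close>.\<close>
    also have "\<dots> = sum p UNIV * (R + \<gamma> $ i0 + Phi G - G $ i0) + real CARD('n) * b - \<gamma> $ i0"
      by (simp add: sum.distrib sum_subtractf sum_distrib_right)
    finally show ?thesis
      unfolding sp by (simp add: p_def G_def R_def U_def)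
  qed
  have main: "(\<Sum>h\<in>H k. pp k h * U k h) \<le> Phi 0 + real k * (real CARD('n) * b)" if "k \<le> T" for k
    using that
  proof (induction k)
    case 0
    show ?case
      using Phi_ge by (simp add: H_def pp_def gbpa_path_prob_def U_def Gh_def)
  next
    case (Suc k)
    have "(\<Sum>h\<in>H (Suc k). pp (Suc k) h * U (Suc k) h)
        \<le> (\<Sum>h\<in>H k. pp k h * (U k h + real CARD('n) * b))"
      unfolding sumH using Suc.prems by (intro sum_mono mult_left_mono step pp0) auto
    also have "\<dots> = (\<Sum>h\<in>H k. pp k h * U k h) + (\<Sum>h\<in>H k. pp k h) * (real CARD('n) * b)"
      by (simp add: distrib_left sum.distrib sum_distrib_right)
    also have "\<dots> \<le> Phi 0 + real (Suc k) * (real CARD('n) * b)"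
      using Suc by (simp add: pp1 algebra_simps)
    finally show ?case .
  qed
  have "regret g T h \<le> U T h" for h
  proof -
    have "regret g T h \<le> (\<Sum>t\<in>{1..T}. g t $ i0 - g t $ h t)"
      unfolding regret_def using i0 by (subst Max_le_iff) (auto simp: sum_subtractf)
    also have "\<dots> \<le> U T h" using Phi_ge[of "Gh h T" i0] by (simp add: U_def)
    finally show ?thesis .
  qed
  then have "gbpa_expected_regret Phi g T \<le> (\<Sum>h\<in>H T. pp T h * U T h)"
    unfolding gbpa_expected_regret_def P_def[symmetric] pp_def[symmetric] H_def[symmetric]
    by (intro sum_mono mult_left_mono pp0)
  also have "\<dots> \<le> Phi 0 + real T * (real CARD('n) * b)" by (rule main) simp
  finally show ?thesis .
qed

subsection \<open>Tuning the scale\<close>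

lemma ln_gt_three_halves:
  assumes "T > 4" shows "3 / 2 < ln (real T)"
proof -
  have "exp (3 / 2 :: real) ^ 2 = exp 1 ^ 3"
    by (simp add: exp_of_nat_mult[symmetric])
  also have "\<dots> < (272 / 100) ^ 3"
    using e_less_272 by (intro power_strict_mono) auto
  also have "\<dots> < 5 ^ 2" by (simp add: power2_eq_square power3_eq_cube)
  finally have "exp (3 / 2 :: real) < 5" by (rule power_less_imp_less_base) simp
  also have "\<dots> \<le> real T" using assms by simp
  finally have "ln (exp (3 / 2)) < ln (real T)" using assms by (subst ln_less_cancel_iff) auto
  then show ?thesis by simp
qed

text \<open>The reason for tuning to \<open>1 / ln T\<close>: a surplus factor
  \<open>T powr a\<close> is then the constant \<open>exp 1\<close>.\<close>

lemma powr_inverse_ln: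
  assumes "1 < x" shows "x powr (1 / ln x) = exp (1::real)"
  using assms by (simp add: powr_def)

text \<open>The choice of \<open>eta\<close> makes the accumulated divergence equal to
  \<open>3 / 2 * (1 - a)\<close> times \<open>eta * S\<close>, so only \<open>eta * S\<close> has to
  be estimated.\<close>

lemma tuned_scale_bound:
  fixes N S a eta :: real and T :: nat
  assumes N: "2 \<le> N" and T: "4 < T" and a: "a = 1 / ln (real T)"
    and S: "S = sqrt (2 * ln N)"
    and eta: "eta = (4 * N * real T / (a * (1 - a) * S)) powr (1 / (2 - a))"
  shows "eta * S + real T * (N * (6 / a * eta powr (a - 1)))
      \<le> 96 * sqrt (N * real T) * N powr a * sqrt (ln N) * ln (real T)"
proof -
  define L where "L = ln (real T)"
  define Q where "Q = 4 * N * real T / (a * (1 - a) * S)"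
  define e where "e = 1 / (2 - a)"
  have L: "3 / 2 < L" unfolding L_def using T by (rule ln_gt_three_halves)
  have aL: "a * L = 1" using L by (simp add: a L_def)
  have a0: "0 < a" "a < 2 / 3" using L by (auto simp: a L_def[symmetric] field_simps)
  have "1 \<le> 2 * ln (2::real)" using ln2_ge_two_thirds by simp
  also have "\<dots> \<le> 2 * ln N" using N by simp
  finally have S1: "1 \<le> S" by (simp add: S)
  have T0: "4 < real T" using T by simp
  have Q0: "0 < Q" using N T0 a0 S1 by (simp add: Q_def)
  have etaQ: "eta = Q powr e" by (simp add: eta Q_def e_def)
  have eta0: "0 < eta" using Q0 by (simp add: etaQ)
  \<comment> \<open>Rearranges \<open>eta powr (2 - a) = Q\<close>, the equation that
    \<open>eta\<close> solves.\<close>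
  have "eta powr (a - 1) = eta / Q"
  proof -
    have "eta powr (2 - a) = Q"
      using a0 Q0 by (simp add: etaQ powr_powr e_def)
    then have "eta powr 1 / eta powr (2 - a) = eta / Q"
      using eta0 by simp
    then show ?thesis by (simp only: powr_diff[symmetric]) simp
  qed
  then have "real T * (N * (6 / a * eta powr (a - 1))) = 3 / 2 * (1 - a) * (eta * S)"
    using N T0 a0 S1 by (simp add: Q_def field_simps)
  also have "\<dots> \<le> 3 / 2 * (eta * S)"
    using a0 eta0 S1 by (intro mult_right_mono) auto
  finally have 1: "eta * S + real T * (N * (6 / a * eta powr (a - 1))) \<le> 5 / 2 * (eta * S)"
    by linarith
  have e: "1 / 2 \<le> e" "e \<le> 1" "e \<le> 1 / 2 + a / 2"
  proof -
    show "1 / 2 \<le> e" "e \<le> 1" using a0 by (auto simp: e_def field_simps)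
    have "0 \<le> a * (1 - a)" using a0 by simp
    then have "2 \<le> (1 + a) * (2 - a)" by (simp add: algebra_simps)
    then show "e \<le> 1 / 2 + a / 2" using a0 by (simp add: e_def field_simps)
  qed
  have Q': "Q = 4 / (1 - a) * (N * real T) * L / S"
    using aL a0 S1 L by (simp add: Q_def a L_def[symmetric] field_simps)
  have "eta = (4 / (1 - a)) powr e * (N * real T) powr e * L powr e / S powr e"
    unfolding etaQ Q' using a0 N T0 L S1 by (simp add: powr_mult powr_divide)
  \<comment> \<open>Factor by factor: \<open>a < 2 / 3\<close> gives
    \<open>4 / (1 - a) \<le> 12\<close>; the exponent \<open>e \<le> 1 / 2 + a / 2\<close> gives a
    square root times a half power of \<open>exp 1\<close>, at most 17/10; the rest uses
    \<open>1 \<le> L\<close> and \<open>1 \<le> S\<close>.\<close>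
  also have "\<dots> \<le> 12 * (sqrt (N * real T) * (N powr a * (17 / 10))) * L / 1"
  proof (intro frac_le mult_mono)
    have "(4 / (1 - a)) powr e \<le> (4 / (1 - a)) powr 1"
      using a0 e by (intro powr_mono) (auto simp: field_simps)
    also have "\<dots> \<le> 12" using a0 by (simp add: field_simps)
    finally show "(4 / (1 - a)) powr e \<le> 12" .
    have "1 \<le> N * real T" using N T0 mult_mono[of 1 N 1 "real T"] by simp
    then have "(N * real T) powr e \<le> (N * real T) powr (1 / 2 + a / 2)"
      using e by (intro powr_mono)
    also have "\<dots> = sqrt (N * real T) * (N powr (a / 2) * real T powr (a / 2))"
      using N T0 by (simp add: powr_add powr_half_sqrt powr_mult real_sqrt_mult)
    also have "\<dots> \<le> sqrt (N * real T) * (N powr a * (17 / 10))"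
    proof (intro mult_left_mono mult_mono)
      show "N powr (a / 2) \<le> N powr a" using N a0 by (intro powr_mono) auto
      have "(real T powr (a / 2))\<^sup>2 = real T powr a"
        using T0 by (simp add: power2_eq_square powr_add[symmetric])
      also have "\<dots> = exp 1" using T0 by (simp add: a powr_inverse_ln)
      also have "\<dots> \<le> (17 / 10)\<^sup>2" using e_less_272 by (simp add: power2_eq_square)
      finally show "real T powr (a / 2) \<le> 17 / 10" by (rule power2_le_imp_le) simp
    qed (use N T0 in auto)
    finally show "(N * real T) powr e \<le> sqrt (N * real T) * (N powr a * (17 / 10))" .
    show "L powr e \<le> L" using L e powr_mono[of e 1 L] by simp
    show "1 \<le> S powr e" using S1 e by (intro ge_one_powr_ge_zero) auto
  qed (use L N T0 in auto)
  finally have "eta \<le> 12 * (sqrt (N * real T) * (N powr a * (17 / 10))) * L"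
    by simp
  moreover have "S \<le> 3 / 2 * sqrt (ln N)"
  proof -
    have "sqrt 2 \<le> (3 / 2 :: real)" by (rule real_le_lsqrt) (auto simp: power2_eq_square)
    then show ?thesis
      using N by (simp add: S real_sqrt_mult mult_right_mono)
  qed
  ultimately have "eta * S \<le> 12 * (sqrt (N * real T) * (N powr a * (17 / 10))) * L * (3 / 2 * sqrt (ln N))"
    using L N T0 S1 eta0 by (intro mult_mono) auto
  also have "\<dots> = 153 / 5 * (sqrt (N * real T) * N powr a * sqrt (ln N) * L)"
    by simp
  \<comment> \<open>The collected constant 153/2 is the product of 5/2, 12, 17/10 and 3/2; it stays
    below 96.\<close>
  finally have "5 / 2 * (eta * S) \<le> 153 / 2 * (sqrt (N * real T) * N powr a * sqrt (ln N) * L)"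
    by linarith
  also have "\<dots> \<le> 96 * (sqrt (N * real T) * N powr a * sqrt (ln N) * L)"
    using N T0 L by (intro mult_right_mono) auto
  finally show ?thesis
    using 1 unfolding L_def by (simp only: mult.assoc)
qed

theorem theorem4:
  fixes g :: "nat \<Rightarrow> real ^ 'n::finite" and T :: nat and alpha eta :: real
  assumes N2: "CARD('n) \<ge> 2"
    and T4: "T > 4"
    and alpha_def: "alpha = 1 / ln (real T)"
    and eta_def: "eta = (4 * real CARD('n) * real T
                    / (alpha * (1 - alpha) * sqrt (2 * ln (real CARD('n))))) powr (1 / (2 - alpha))"
    and gains: "\<And>t i. t \<in> {1..T} \<Longrightarrow> g t $ i \<in> {-1..0}"
  shows "gbpa_expected_regret (gauss_smoothed_potential eta) g T
           \<le> 96 * sqrt (real CARD('n) * real T) * real CARD('n) powr (1 / ln (real T))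
               * sqrt (ln (real CARD('n))) * ln (real T)
         \<and> (T > CARD('n) \<longrightarrow> gbpa_expected_regret (gauss_smoothed_potential eta) g T
           \<le> 278 * sqrt (real CARD('n) * real T) * sqrt (ln (real CARD('n))) * ln (real T))"
proof -
  define N where "N = real CARD('n)"
  have N: "2 \<le> N" using N2 by (simp add: N_def)
  have L: "3 / 2 < ln (real T)" using T4 by (rule ln_gt_three_halves)
  then have alpha: "0 < alpha" "alpha \<le> 1" "alpha < 1" by (auto simp: alpha_def field_simps)
  have eta0: "0 < eta"
    unfolding eta_def using alpha N T4 by (simp add: N_def)
  note grad_eq = grad_gauss_smoothed_potential[OF eta0[THEN less_imp_neq, symmetric]]
  have "gbpa_expected_regret (gauss_smoothed_potential eta) g T
      \<le> gauss_smoothed_potential eta (0 :: real ^ 'n)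
        + real T * (real CARD('n) * (6 / alpha * eta powr (alpha - 1)))"
  proof (rule gbpa_expected_regret_le)
    show "(\<Sum>i\<in>UNIV. grad (gauss_smoothed_potential eta) G $ i) = 1" for G :: "real ^ 'n"
      using eta0 by (simp add: grad_eq sum_lead_prob)
  qed (use gains in \<open>simp_all only: grad_eq gauss_smoothed_potential_ge lead_prob_pos[OF eta0 N2]
         gauss_smoothed_potential_divergence[OF eta0 N2 alpha(1,2)]\<close>)
  also have "\<dots> \<le> eta * sqrt (2 * ln N) + real T * (N * (6 / alpha * eta powr (alpha - 1)))"
    using gauss_smoothed_potential_zero_le[where 'n = 'n, of eta] eta0 N2 by (simp add: N_def)
  also have "\<dots> \<le> 96 * sqrt (N * real T) * N powr alpha * sqrt (ln N) * ln (real T)"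
    by (rule tuned_scale_bound[OF N T4 alpha_def refl]) (simp add: eta_def N_def)
  finally have bound: "gbpa_expected_regret (gauss_smoothed_potential eta) g T
      \<le> 96 * sqrt (N * real T) * N powr alpha * sqrt (ln N) * ln (real T)" .
  have "gbpa_expected_regret (gauss_smoothed_potential eta) g T
      \<le> 278 * sqrt (N * real T) * sqrt (ln N) * ln (real T)" if "CARD('n) < T"
  proof -
    define R where "R = sqrt (N * real T) * sqrt (ln N) * ln (real T)"
    have R: "0 \<le> R" using N L by (simp add: R_def)
    \<comment> \<open>With fewer arms than rounds the factor \<open>N powr alpha\<close> is at most
      \<open>exp 1\<close>, and 96 times 2.72 is below 278.\<close>
    have "N powr alpha \<le> real T powr alpha"
      using that alpha by (intro powr_mono2) (auto simp: N_def)
    also have "\<dots> = exp 1" using T4 by (simp add: alpha_def powr_inverse_ln)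
    also have "\<dots> \<le> 278 / 96" using e_less_272 by simp
    finally have "96 * N powr alpha * R \<le> 278 * R"
      using R by (intro mult_right_mono) auto
    then show ?thesis using bound by (simp add: R_def mult_ac)
  qed
  with bound show ?thesis by (simp add: N_def alpha_def)
qed

end
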